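(* Let $\{\nu_\varepsilon\}_{\varepsilon>0}$ be a family of positive Borel measures on $\mathbb{R}^d$ such that $\int_{\mathbb{R}^d}(1\wedge|x|)\,\nu_\varepsilon(\mathrm{d}x)<\infty$ and $\nu_\varepsilon(\{0\})=0$ for every $\varepsilon>0$. Let $$\lambda_\varepsilon(\mathrm{d}x)=C_\varepsilon^{-1}(1\wedge R_\varepsilon|x|)\,\nu_\varepsilon(\mathrm{d}x),$$ where $C_\varepsilon=\int_{\mathbb{R}^d}(1\wedge R_\varepsilon|x|)\,\nu_\varepsilon(\mathrm{d}x)$, $R_\varepsilon\in[1,\infty]$, and $0<C_\varepsilon<\infty$. Assume that, for any $R>0$, $$\lim_{\varepsilon\downarrow0}\lambda_\varepsilon(B_R^c)=1.$$ Then for any Borel set $E\subset\mathbb{R}^d$ of finite Lebesgue measure and of finite perimeter $$\lim_{\varepsilon\downarrow0}C_\varepsilon^{-1}\,\mathrm{Per}_{\nu_\varepsilon}(E)=|E|.$$ Furthermore, if $\{\nu_\varepsilon\}_{\varepsilon>0}$ is a family of finite measures, then for any Borel set $E\subset\mathbb{R}^d$ of finite Lebesgue measure $$\lim_{\varepsilon\downarrow0}(\nu_\varepsilon(\mathbb{R}^d))^{-1}\,\mathrm{Per}_{\nu_\varepsilon}(E)=|E|.$$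
   Context: $a\wedge b=\min(a,b)$; for $R_\varepsilon=\infty$ one reads $1\wedge R_\varepsilon|x|=1$ for $x\neq0$. $B_R$ is the closed Euclidean ball of radius $R$ centred at $0$ and $B_R^c$ its complement. $|E|$ denotes the Lebesgue measure of $E$. For a positive Borel measure $\nu$ on $\mathbb{R}^d$ and a Borel set $E\subset\mathbb{R}^d$, the non-local $\nu$-perimeter is $\mathrm{Per}_\nu(E)=\int_E\int_{E^c-x}\nu(\mathrm{d}y)\,\mathrm{d}x=\int_E\nu(E^c-x)\,\mathrm{d}x$. The set $E$ has finite perimeter if $|D\mathbf{1}_E|(\mathbb{R}^d)<\infty$, where $D\mathbf{1}_E$ is the distributional gradient of the indicator function $\mathbf{1}_E$ and $|D\mathbf{1}_E|$ its total variation measure.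
   Formalization: The "furthermore" part is proved with $R_\varepsilon=\infty$ for all $\varepsilon$ (so $C_\varepsilon=\nu_\varepsilon(\mathbb{R}^d)$); for general $R_\varepsilon$ it fails, e.g. $d=1$, $R_\varepsilon=1$, $\nu_\varepsilon=\delta_{1/\varepsilon}+\varepsilon^{-1}\delta_{\varepsilon^2}$, $E=[0,1]$. *)

theory Defs
  imports "HOL-Analysis.Analysis"
begin

subsection \<open>Distributional gradient and sets of finite perimeter\<close>

fun C_k :: "nat \<Rightarrow> ('a::euclidean_space \<Rightarrow> 'b::real_normed_vector) \<Rightarrow> bool" where
  "C_k 0 f \<longleftrightarrow> continuous_on UNIV f"
| "C_k (Suc k) f \<longleftrightarrow>
     (\<forall>x. f differentiable (at x)) \<and> (\<forall>v. C_k k (\<lambda>x. frechet_derivative f (at x) v))"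

definition smooth :: "('a::euclidean_space \<Rightarrow> 'b::real_normed_vector) \<Rightarrow> bool" where
  "smooth f \<longleftrightarrow> (\<forall>k. C_k k f)"

definition supp :: "('a::topological_space \<Rightarrow> 'b::zero) \<Rightarrow> 'a set" where
  "supp f = closure {x. f x \<noteq> 0}"

definition test_fields :: "'a set \<Rightarrow> ('a::euclidean_space \<Rightarrow> 'a) set" where
  "test_fields U = {\<phi>. smooth \<phi> \<and> compact (supp \<phi>) \<and> supp \<phi> \<subseteq> U}"

definition divergence :: "('a::euclidean_space \<Rightarrow> 'a) \<Rightarrow> 'a \<Rightarrow> real" where
  "divergence \<phi> x = (\<Sum>b\<in>Basis. frechet_derivative \<phi> (at x) b \<bullet> b)"

text \<open>A vector-valued distribution is represented as a functional on vector-valued test functions.\<close>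

definition distributional_gradient ::
    "('a::euclidean_space \<Rightarrow> real) \<Rightarrow> ('a \<Rightarrow> 'a) \<Rightarrow> real" where
  "distributional_gradient u \<phi> = - (\<integral>x. u x * divergence \<phi> x \<partial>lborel)"

text \<open>
  The total variation of a vector-valued distribution is given on open sets by duality with test
  fields bounded by \<open>1\<close>, and on arbitrary sets by outer regularity.  It makes sense for every
  distribution; if it is finite on the whole space, the distribution is a vector-valued measure
  and this is its total variation measure.
\<close>

definition total_variation ::
    "(('a::euclidean_space \<Rightarrow> 'a) \<Rightarrow> real) \<Rightarrow> 'a set \<Rightarrow> ennreal" where
  "total_variation T A =
     (INF U\<in>{U. open U \<and> A \<subseteq> U}.
        SUP \<phi>\<in>{\<phi> \<in> test_fields U. \<forall>x. norm (\<phi> x) \<le> 1}. ennreal \<bar>T \<phi>\<bar>)"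

definition finite_perimeter :: "'a::euclidean_space set \<Rightarrow> bool" where
  "finite_perimeter E \<longleftrightarrow>
     total_variation (distributional_gradient (indicat_real E)) UNIV < \<infinity>"

lemma total_variation_UNIV:
  "total_variation T UNIV =
     (SUP \<phi>\<in>{\<phi> \<in> test_fields UNIV. \<forall>x. norm (\<phi> x) \<le> 1}. ennreal \<bar>T \<phi>\<bar>)"
proof -
  have "{U. open U \<and> UNIV \<subseteq> U} = {UNIV :: 'a set}"
    by auto
  then show ?thesis
    unfolding total_variation_def by simp
qed

subsection \<open>Non-local perimeter and the normalised measures\<close>

definition nonlocal_perimeter ::
    "'a::euclidean_space measure \<Rightarrow> 'a set \<Rightarrow> ennreal" where
  "nonlocal_perimeter \<nu> E = (\<integral>\<^sup>+x\<in>E. emeasure \<nu> ((\<lambda>z. z - x) ` (- E)) \<partial>lborel)"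

text \<open>
  For \<open>r = \<infinity>\<close> the weight is \<open>1\<close> off the origin, since \<open>\<infinity> * 0 = 0\<close> and \<open>\<infinity> * t = \<infinity>\<close> for
  \<open>t > 0\<close> in the extended non-negative reals.
\<close>

definition trunc_weight :: "ennreal \<Rightarrow> 'a::real_normed_vector \<Rightarrow> ennreal" where
  "trunc_weight r x = min 1 (r * ennreal (norm x))"

lemma trunc_weight_infinity: "x \<noteq> 0 \<Longrightarrow> trunc_weight \<infinity> x = 1"
  by (simp add: trunc_weight_def ennreal_top_mult)

definition trunc_mass :: "ennreal \<Rightarrow> 'a::real_normed_vector measure \<Rightarrow> ennreal" where
  "trunc_mass r \<nu> = (\<integral>\<^sup>+x. trunc_weight r x \<partial>\<nu>)"

definition trunc_normalized ::
    "ennreal \<Rightarrow> 'a::real_normed_vector measure \<Rightarrow> 'a measure" where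
  "trunc_normalized r \<nu> = density \<nu> (\<lambda>x. inverse (trunc_mass r \<nu>) * trunc_weight r x)"

end

theory Submission
  imports Defs "HOL-Computational_Algebra.Polynomial"
begin

text \<open>
  By Tonelli, the non-local perimeter is the \<open>\<nu>\<close>-integral of \<open>g y = |E - (E - y)|\<close>.  Here
  \<open>g \<le> |E|\<close>, \<open>g y\<close> tends to \<open>|E|\<close> as \<open>|y| \<longlongrightarrow> \<infinity>\<close> because the translates of \<open>E\<close> separate, and for
  a set of finite perimeter \<open>g y \<le> V |y|\<close>.  Hence \<open>g\<close> is bounded by a multiple of the truncated
  weight, so the vanishing \<open>\<lambda>\<close>-mass of balls contributes nothing in the limit, while the mass that
  escapes to infinity sees \<open>g \<approx> |E|\<close>.

  The estimate \<open>g y \<le> V |y|\<close> comes from testing the distributional gradient with translates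
  of smooth functions that approximate the indicator of an open set, and from outer regularity.
\<close>

subsection \<open>Smooth approximation of indicators of open sets\<close>

lemma C_k_SucI:
  assumes "\<And>x. (f has_derivative f' x) (at x)" and "\<And>v. C_k k (\<lambda>x. f' x v)"
  shows "C_k (Suc k) f"
proof -
  \<comment> \<open>Derivatives are unique, so any explicit derivative may stand in for the chosen
    one in \<open>C_k\<close>. The closure properties below thus reduce to derivative rules and
    induction on the order.\<close>
  have "frechet_derivative f (at x) = f' x" for x
    using assms(1) frechet_derivative_at by metis
  with assms show ?thesis by (auto simp: differentiable_def)
qed

lemma C_k_SucD:
  assumes "C_k (Suc k) f"
  shows "(f has_derivative frechet_derivative f (at x)) (at x)"
    and "C_k k (\<lambda>x. frechet_derivative f (at x) v)"
  using assms by (auto simp: frechet_derivative_works)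

text \<open>Used for products: the Leibniz rule leaves one factor undifferentiated, and that factor
  has to be lowered by one order before the induction hypothesis applies.\<close>

lemma C_k_Suc_imp: "C_k (Suc k) f \<Longrightarrow> C_k k f"
proof (induction k arbitrary: f)
  case 0
  then have "(f has_derivative frechet_derivative f (at x)) (at x)" for x
    by (rule C_k_SucD)
  then show ?case
    by (auto intro!: continuous_at_imp_continuous_on has_derivative_continuous)
next
  case (Suc k)
  show ?case
    by (rule C_k_SucI[where f' = "\<lambda>x. frechet_derivative f (at x)"])
      (use Suc in \<open>auto simp: frechet_derivative_works\<close>)
qed

lemma C_k_const: "C_k k (\<lambda>x. c)"
proof (induction k arbitrary: c)
  case (Suc k)
  show ?case by (rule C_k_SucI[where f' = "\<lambda>x v. 0"]) (auto intro: Suc)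
qed auto

lemma C_k_diff:
  "C_k k f \<Longrightarrow> C_k k g \<Longrightarrow> C_k k (\<lambda>x. f x - g x)"
proof (induction k arbitrary: f g)
  case 0
  then show ?case by (auto intro: continuous_intros)
next
  case (Suc k)
  show ?case
    by (rule C_k_SucI[OF has_derivative_diff[OF C_k_SucD(1)[OF Suc.prems(1)] C_k_SucD(1)[OF Suc.prems(2)]]])
      (intro Suc.IH C_k_SucD(2) Suc.prems)
qed

lemma C_k_add:
  "C_k k f \<Longrightarrow> C_k k g \<Longrightarrow> C_k k (\<lambda>x. f x + g x)"
  using C_k_diff[of k f "\<lambda>x. 0 - g x"] C_k_diff[OF C_k_const[of k 0], of g] by simp

lemma C_k_mult:
  fixes f g :: "'a::euclidean_space \<Rightarrow> real"
  shows "C_k k f \<Longrightarrow> C_k k g \<Longrightarrow> C_k k (\<lambda>x. f x * g x)"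
proof (induction k arbitrary: f g)
  case 0
  then show ?case by (auto intro: continuous_intros)
next
  case (Suc k)
  show ?case
    by (rule C_k_SucI[OF has_derivative_mult[OF C_k_SucD(1)[OF Suc.prems(1)] C_k_SucD(1)[OF Suc.prems(2)]]])
      (intro C_k_add Suc.IH C_k_SucD(2) Suc.prems C_k_Suc_imp)
qed

lemma C_k_prod:
  fixes f :: "'i \<Rightarrow> 'a::euclidean_space \<Rightarrow> real"
  assumes "\<And>i. i \<in> I \<Longrightarrow> C_k k (f i)"
  shows "C_k k (\<lambda>x. \<Prod>i\<in>I. f i x)"
  using assms by (induction I rule: infinite_finite_induct) (auto intro: C_k_const C_k_mult)

lemma C_k_power:
  fixes f :: "'a::euclidean_space \<Rightarrow> real"
  shows "C_k k f \<Longrightarrow> C_k k (\<lambda>x. f x ^ n)"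
  using C_k_prod[of "{..<n}" k "\<lambda>_. f"] by simp

lemma C_k_scaleR_const:
  fixes f :: "'a::euclidean_space \<Rightarrow> real"
  shows "C_k k f \<Longrightarrow> C_k k (\<lambda>x. f x *\<^sub>R u)"
proof (induction k arbitrary: f)
  case 0
  then show ?case by (auto intro: continuous_intros)
next
  case (Suc k)
  show ?case
    by (rule C_k_SucI[OF has_derivative_scaleR_left[OF C_k_SucD(1)[OF Suc.prems]]])
      (intro Suc.IH C_k_SucD(2) Suc.prems)
qed

lemma C_k_translate: "C_k k f \<Longrightarrow> C_k k (\<lambda>x. f (x - c))"
proof (induction k arbitrary: f)
  case 0
  then have "continuous_on UNIV f" by simp
  then show ?case
    by (auto intro!: continuous_on_compose2[of UNIV f] continuous_intros)
next
  case (Suc k)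
  have *: "((\<lambda>x. f (x - c)) has_derivative frechet_derivative f (at (x - c))) (at x)" for x
    by (rule has_derivative_compose[of "\<lambda>x. x - c" "\<lambda>v. v", simplified])
      (auto intro!: derivative_eq_intros C_k_SucD(1)[OF Suc.prems])
  show ?case
    by (rule C_k_SucI[OF *]) (rule Suc.IH[OF C_k_SucD(2)[OF Suc.prems]])
qed

section \<open>The flat function exp(-1/t) and its derivatives\<close>

definition flat_exp :: "real poly \<Rightarrow> real \<Rightarrow> real" where
  "flat_exp p t = (if t > 0 then poly p (1 / t) * exp (- (1 / t)) else 0)"

lemma poly_times_exp_minus_tendsto_0:
  fixes p :: "real poly"
  shows "((\<lambda>s. poly p s * exp (- s)) \<longlongrightarrow> 0) at_top"
proof -
  \<comment> \<open>The extra power makes the induction on \<open>p\<close> work: in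
    \<open>pCons a p\<close> the tail carries one more factor \<open>s\<close>, which is absorbed
    into \<open>s ^ Suc k\<close>.\<close>
  have "((\<lambda>s. s ^ k * poly p s * exp (- s)) \<longlongrightarrow> 0) at_top" for k
  proof (induction p arbitrary: k)
    case (pCons a p)
    have "((\<lambda>s. a * (s ^ k / exp s) + s ^ Suc k * poly p s * exp (- s)) \<longlongrightarrow> a * 0 + 0) at_top"
      by (intro tendsto_intros tendsto_power_div_exp_0 pCons.IH)
    then show ?case by (simp add: exp_minus field_simps)
  qed simp
  from this[of 0] show ?thesis by simp
qed

text \<open>With s = 1/t, differentiation in t is -s^2 times differentiation in s, which sends p(s)
  exp(-s) to s^2 (p - p')(s) exp(-s); \<open>[:0, 0, 1:]\<close> is s^2. The family is thus closed
  under differentiation, and smoothness of all its members follows by one induction.\<close>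

lemma flat_exp_has_real_derivative:
  "(flat_exp p has_real_derivative flat_exp ([:0, 0, 1:] * (p - pderiv p)) t) (at t)"
proof -
  consider "t > 0" | "t < 0" | "t = 0" by linarith
  then show ?thesis
  proof cases
    case 1
    have "((\<lambda>t. poly p (1 / t) * exp (- (1 / t))) has_real_derivative
        flat_exp ([:0, 0, 1:] * (p - pderiv p)) t) (at t)"
      using 1 by (auto intro!: derivative_eq_intros DERIV_chain2[OF poly_DERIV]
          simp: flat_exp_def field_simps power2_eq_square)
    then show ?thesis
      by (rule has_field_derivative_transform_within_open[of _ _ _ "{0<..}"])
        (use 1 in \<open>auto simp: flat_exp_def\<close>)
  next
    case 2
    have "((\<lambda>t. 0) has_real_derivative flat_exp ([:0, 0, 1:] * (p - pderiv p)) t) (at t)"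
      using 2 by (simp add: flat_exp_def)
    then show ?thesis
      by (rule has_field_derivative_transform_within_open[of _ _ _ "{..<0}"])
        (use 2 in \<open>auto simp: flat_exp_def\<close>)
  next
    case 3
    \<comment> \<open>At the origin the difference quotient divides by h, that is, multiplies the
      polynomial in 1/h by its variable: hence \<open>pCons 0 p\<close>.\<close>
    have "((\<lambda>h. poly (pCons 0 p) (inverse h) * exp (- inverse h)) \<longlongrightarrow> 0) (at_right 0)"
      by (rule filterlim_compose[OF poly_times_exp_minus_tendsto_0 filterlim_inverse_at_top_right])
    moreover have "\<forall>\<^sub>F h in at_right 0.
        poly (pCons 0 p) (inverse h) * exp (- inverse h) = flat_exp p h / h"
      using eventually_at_right_less by eventually_elim (simp add: flat_exp_def field_simps)
    ultimately have "((\<lambda>h. flat_exp p h / h) \<longlongrightarrow> 0) (at_right 0)"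
      by (rule Lim_transform_eventually)
    moreover have "((\<lambda>h. flat_exp p h / h) \<longlongrightarrow> 0) (at_left 0)"
    proof (rule Lim_transform_eventually[OF tendsto_const])
      show "\<forall>\<^sub>F h in at_left 0. 0 = flat_exp p h / h"
        unfolding eventually_at_left_field by (auto simp: flat_exp_def intro!: exI[of _ "-1"])
    qed
    ultimately have "((\<lambda>h. flat_exp p h / h) \<longlongrightarrow> 0) (at 0)"
      by (rule filterlim_split_at[rotated])
    then show ?thesis using 3 by (simp add: DERIV_def flat_exp_def)
  qed
qed

lemma C_k_flat_exp: "C_k k (\<lambda>x::'a::euclidean_space. flat_exp p (x \<bullet> v + c))"
proof (induction k arbitrary: p)
  case 0
  have "continuous_on UNIV (flat_exp p)"
    by (auto intro!: continuous_at_imp_continuous_on DERIV_isCont flat_exp_has_real_derivative)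
  then show ?case
    by (auto intro!: continuous_on_compose2[of UNIV "flat_exp p"] continuous_intros)
next
  case (Suc k)
  let ?q = "[:0, 0, 1:] * (p - pderiv p)"
  have "((\<lambda>x. flat_exp p (x \<bullet> v + c)) has_derivative (\<lambda>w. flat_exp ?q (x \<bullet> v + c) * (w \<bullet> v))) (at x)" for x
    by (rule has_derivative_compose[where f = "\<lambda>x. x \<bullet> v + c" and f' = "\<lambda>w. w \<bullet> v",
          OF _ flat_exp_has_real_derivative[unfolded has_field_derivative_def]])
      (auto intro!: derivative_eq_intros)
  then show ?case
    by (rule C_k_SucI) (intro C_k_mult Suc.IH C_k_const)
qed

section \<open>Smooth bumps on boxes, with one flat factor for each face\<close>

definition box_bump :: "'a::euclidean_space \<Rightarrow> 'a \<Rightarrow> 'a \<Rightarrow> real" where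
  "box_bump a b x = (\<Prod>i\<in>Basis. flat_exp 1 (x \<bullet> i - a \<bullet> i) * flat_exp 1 (b \<bullet> i - x \<bullet> i))"

lemma flat_exp_1_bounds: "0 \<le> flat_exp 1 t" "flat_exp 1 t \<le> 1"
  by (auto simp: flat_exp_def)

lemma C_k_box_bump: "C_k k (box_bump a b)"
proof -
  have "C_k k (\<lambda>x. flat_exp 1 (x \<bullet> i - a \<bullet> i))" "C_k k (\<lambda>x. flat_exp 1 (b \<bullet> i - x \<bullet> i))" for i
    using C_k_flat_exp[of k 1 i "- (a \<bullet> i)"] C_k_flat_exp[of k 1 "-i" "b \<bullet> i"]
    by (simp_all add: algebra_simps)
  then show ?thesis unfolding box_bump_def by (intro C_k_prod C_k_mult)
qed

lemma box_bump_bounds: "0 \<le> box_bump a b x" "box_bump a b x \<le> 1"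
  unfolding box_bump_def
  by (auto intro!: prod_nonneg prod_le_1 mult_nonneg_nonneg mult_le_one flat_exp_1_bounds)

lemma box_bump_pos_iff: "box_bump a b x > 0 \<longleftrightarrow> x \<in> box a b"
proof -
  have "box_bump a b x = 0 \<longleftrightarrow> x \<notin> box a b"
    by (force simp: box_bump_def flat_exp_def mem_box not_less)
  then show ?thesis using box_bump_bounds(1)[of a b x] by linarith
qed

text \<open>An open set is a countable union of open boxes, and each box carries a smooth bump.
  Bounded supports make the functions usable in test fields; pointwise convergence within [0, 1] is
  the form that dominated convergence takes up later.\<close>

lemma smooth_approx_indicator_open:
  fixes U :: "'a::euclidean_space set"
  assumes "open U"
  obtains \<psi> :: "nat \<Rightarrow> 'a \<Rightarrow> real"
  where "\<And>n. smooth (\<psi> n)" "\<And>n. bounded {x. \<psi> n x \<noteq> 0}"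
    "\<And>n x. 0 \<le> \<psi> n x \<and> \<psi> n x \<le> 1" "\<And>x. (\<lambda>n. \<psi> n x) \<longlonglongrightarrow> indicat_real U x"
proof -
  obtain \<D> where \<D>: "countable \<D>" "\<And>X. X \<in> \<D> \<Longrightarrow> \<exists>a b. X = box a b" "\<Union>\<D> = U"
    using open_countable_Union_open_box[OF assms] by metis
  \<comment> \<open>Inserting the empty set keeps the enumeration valid when there are no boxes at
    all, as for an empty \<open>U\<close>; it is itself the degenerate box
    \<open>box 0 0\<close>.\<close>
  define B where "B = from_nat_into (insert {} \<D>)"
  have rangeB: "range B = insert {} \<D>"
    unfolding B_def using \<D>(1) by (intro range_from_nat_into) auto
  have UB: "U = (\<Union>i. B i)" using rangeB \<D>(3) by auto
  have "\<exists>a b. B i = box a b" for i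
  proof -
    have "B i \<in> insert {} \<D>" using rangeB by auto
    moreover have "{} = box (0::'a) 0" by simp
    ultimately show ?thesis using \<D>(2) by blast
  qed
  then obtain a b where B: "\<And>i. B i = box (a i) (b i)" by metis
  \<comment> \<open>The powers push each factor to \<open>0\<close> on its box, so \<open>\<psi> n\<close> tends to \<open>1\<close> on the union.\<close>
  define \<psi> where "\<psi> n x = 1 - (\<Prod>i<n. (1 - box_bump (a i) (b i) x) ^ n)" for n :: nat and x
  let ?\<beta> = "\<lambda>i x. box_bump (a i) (b i) x"
  have range: "0 \<le> (1 - ?\<beta> i x) ^ n" "(1 - ?\<beta> i x) ^ n \<le> 1" for i n x
    using box_bump_bounds[of "a i" "b i" x] by (auto intro!: power_le_one)
  show ?thesis
  proof
    show "smooth (\<psi> n)" for n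
      unfolding smooth_def \<psi>_def
      by (auto intro!: C_k_diff C_k_const C_k_prod C_k_power C_k_box_bump)
    show "0 \<le> \<psi> n x \<and> \<psi> n x \<le> 1" for n x
      unfolding \<psi>_def by (auto intro!: prod_nonneg prod_le_1 range)
    have zero: "?\<beta> i x = 0" if "x \<notin> B i" for i x
      using that box_bump_pos_iff[of "a i" "b i" x] box_bump_bounds(1)[of "a i" "b i" x] B by force
    show "bounded {x. \<psi> n x \<noteq> 0}" for n
    proof (rule bounded_subset)
      show "bounded (\<Union>i<n. B i)" by (auto simp: B)
      show "{x. \<psi> n x \<noteq> 0} \<subseteq> (\<Union>i<n. B i)"
        by (rule subsetI, rule ccontr) (auto simp: \<psi>_def zero)
    qed
    show "(\<lambda>n. \<psi> n x) \<longlonglongrightarrow> indicat_real U x" for x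
    proof (cases "x \<in> U")
      case True
      then obtain j where j: "x \<in> B j" using UB by auto
      then have \<beta>: "0 < ?\<beta> j x" using B box_bump_pos_iff by metis
      have "(\<lambda>n. (1 - ?\<beta> j x) ^ n) \<longlonglongrightarrow> 0"
        using \<beta> box_bump_bounds(2)[of "a j" "b j" x] by (intro LIMSEQ_realpow_zero) auto
      \<comment> \<open>Once n > j the j-th factor occurs in the product, and the remaining factors
        lie in [0, 1].\<close>
      moreover have le: "\<forall>\<^sub>F n in sequentially. (\<Prod>i<n. (1 - ?\<beta> i x) ^ n) \<le> (1 - ?\<beta> j x) ^ n"
        using eventually_gt_at_top[of j]
      proof eventually_elim
        case (elim n)
        have "(\<Prod>i<n. (1 - ?\<beta> i x) ^ n) = (1 - ?\<beta> j x) ^ n * (\<Prod>i\<in>{..<n} - {j}. (1 - ?\<beta> i x) ^ n)"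
          using elim by (intro prod.remove) auto
        also have "\<dots> \<le> (1 - ?\<beta> j x) ^ n * 1"
          by (intro mult_left_mono prod_le_1 conjI range)
        finally show ?case by simp
      qed
      moreover have ge: "\<forall>\<^sub>F n in sequentially. 0 \<le> (\<Prod>i<n. (1 - ?\<beta> i x) ^ n)"
        by (auto intro!: always_eventually prod_nonneg range)
      ultimately have "(\<lambda>n. (\<Prod>i<n. (1 - ?\<beta> i x) ^ n)) \<longlonglongrightarrow> 0"
        by (intro tendsto_sandwich[OF ge le tendsto_const])
      from tendsto_diff[OF tendsto_const[of 1] this] show ?thesis
        using True unfolding \<psi>_def by simp
    next
      case False
      then have "\<psi> n x = 0" for n using zero UB by (auto simp: \<psi>_def)
      then show ?thesis using False by simp
    qed
  qed
qed

subsection \<open>The translation estimate for sets of finite perimeter\<close>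

lemma lborel_integral_translate:
  fixes f :: "'a::euclidean_space \<Rightarrow> real"
  assumes [measurable]: "f \<in> borel_measurable borel"
  shows "(\<integral>x. f (x + c) \<partial>lborel) = (\<integral>x. f x \<partial>lborel)"
proof -
  have "(\<integral>x. f x \<partial>lborel) = (\<integral>x. f x \<partial>distr lborel borel ((+) c))"
    by (simp add: lborel_distr_plus)
  also have "\<dots> = (\<integral>x. f (c + x) \<partial>lborel)"
    by (rule integral_distr) auto
  finally show ?thesis by (simp add: add.commute)
qed

lemma emeasure_lborel_translate:
  fixes A :: "'a::euclidean_space set"
  assumes [measurable]: "A \<in> sets borel"
  shows "emeasure lborel {x. x + c \<in> A} = emeasure lborel A"
proof -
  have "emeasure lborel A = emeasure (distr lborel borel ((+) c)) A"
    by (simp add: lborel_distr_plus)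
  also have "\<dots> = emeasure lborel ((+) c -` A \<inter> space lborel)"
    by (rule emeasure_distr) auto
  also have "(+) c -` A \<inter> space lborel = {x. x + c \<in> A}"
    by (auto simp: add.commute)
  finally show ?thesis by simp
qed

lemma integrable_indicator_translate:
  fixes E :: "'a::euclidean_space set"
  assumes [measurable]: "E \<in> sets borel" and fin: "emeasure lborel E < \<infinity>"
  shows "integrable lborel (\<lambda>x. indicat_real E (x + y))"
proof -
  have "integrable lborel (indicat_real {x. x + y \<in> E})"
    using fin by (simp add: less_top[symmetric] emeasure_lborel_translate)
  also have "indicat_real {x. x + y \<in> E} = (\<lambda>x. indicat_real E (x + y))"
    by (auto simp: indicator_def)
  finally show ?thesis .
qed

section \<open>Test fields of constant direction\<close>

lemma translated_field_in_test_fields: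
  fixes \<psi> :: "'a::euclidean_space \<Rightarrow> real"
  assumes "smooth \<psi>" and "bounded {x. \<psi> x \<noteq> 0}"
  shows "(\<lambda>x. \<psi> (x - c) *\<^sub>R u) \<in> test_fields UNIV"
proof -
  have "{x. \<psi> (x - c) *\<^sub>R u \<noteq> 0} \<subseteq> (\<lambda>z. c + z) ` {x. \<psi> x \<noteq> 0}"
    by (auto intro!: image_eqI[of _ _ "_ - c"])
  then have "bounded {x. \<psi> (x - c) *\<^sub>R u \<noteq> 0}"
    using bounded_translation[OF assms(2)] bounded_subset by blast
  moreover have "smooth (\<lambda>x. \<psi> (x - c) *\<^sub>R u)"
    unfolding smooth_def
    by (intro allI C_k_scaleR_const C_k_translate) (use assms(1) in \<open>simp add: smooth_def\<close>)
  ultimately show ?thesis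
    unfolding test_fields_def supp_def by auto
qed

text \<open>The direction of the field is constant, so summing the coordinate derivatives against
  the components of \<open>u\<close> reassembles, by linearity, the derivative of \<psi> along
  \<open>u\<close>.\<close>

lemma divergence_translated_field:
  fixes \<psi> :: "'a::euclidean_space \<Rightarrow> real"
  assumes "smooth \<psi>"
  shows "divergence (\<lambda>x. \<psi> (x - c) *\<^sub>R u) x = frechet_derivative \<psi> (at (x - c)) u"
proof -
  let ?D = "frechet_derivative \<psi> (at (x - c))"
  have D: "(\<psi> has_derivative ?D) (at (x - c))"
    using assms C_k_SucD(1)[of 0] unfolding smooth_def by blast
  have "((\<lambda>x. \<psi> (x - c)) has_derivative ?D) (at x)"
    by (rule has_derivative_compose[of "\<lambda>x. x - c" "\<lambda>v. v", simplified])
      (auto intro!: derivative_eq_intros D)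
  then have "((\<lambda>x. \<psi> (x - c) *\<^sub>R u) has_derivative (\<lambda>w. ?D w *\<^sub>R u)) (at x)"
    by (rule has_derivative_scaleR_left)
  then have "frechet_derivative (\<lambda>x. \<psi> (x - c) *\<^sub>R u) (at x) = (\<lambda>w. ?D w *\<^sub>R u)"
    by (rule frechet_derivative_at[symmetric])
  then have "divergence (\<lambda>x. \<psi> (x - c) *\<^sub>R u) x = (\<Sum>b\<in>Basis. (u \<bullet> b) *\<^sub>R ?D b)"
    by (simp add: divergence_def mult.commute)
  also have "\<dots> = ?D (\<Sum>b\<in>Basis. (u \<bullet> b) *\<^sub>R b)"
    using has_derivative_linear[OF D] by (simp add: linear_sum linear_cmul)
  finally show ?thesis by (simp add: euclidean_representation)
qed

text \<open>The derivative is continuous on the compact closure of the support, and off this closure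
  \<psi> vanishes locally. The bound provides the dominating function for differentiation under the
  integral.\<close>

lemma bounded_frechet_derivative:
  fixes \<psi> :: "'a::euclidean_space \<Rightarrow> real"
  assumes "smooth \<psi>" and "bounded {x. \<psi> x \<noteq> 0}"
  obtains M where "\<And>x. \<bar>frechet_derivative \<psi> (at x) v\<bar> \<le> M"
proof -
  let ?S = "closure {x. \<psi> x \<noteq> 0}"
  have "C_k (Suc 0) \<psi>" using assms(1) by (simp only: smooth_def)
  then have "continuous_on ?S (\<lambda>x. frechet_derivative \<psi> (at x) v)"
    using C_k_SucD(2)[of 0] continuous_on_subset by fastforce
  then have "compact ((\<lambda>x. frechet_derivative \<psi> (at x) v) ` ?S)"
    using assms(2) by (intro compact_continuous_image) auto
  then obtain M where M: "\<And>x. x \<in> ?S \<Longrightarrow> \<bar>frechet_derivative \<psi> (at x) v\<bar> \<le> M"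
    by (force dest!: compact_imp_bounded simp: bounded_iff)
  \<comment> \<open>\<open>M\<close> may be negative if the support is empty; the maximum also
    covers the value 0 outside the support.\<close>
  have "\<bar>frechet_derivative \<psi> (at x) v\<bar> \<le> max M 0" for x
  proof (cases "x \<in> ?S")
    case False
    have "(\<psi> has_derivative (\<lambda>_. 0)) (at x)"
    proof (rule has_derivative_transform_within_open)
      show "((\<lambda>_. 0) has_derivative (\<lambda>_. 0)) (at x)" by simp
      show "open (- ?S)" "x \<in> - ?S" using False by auto
      show "0 = \<psi> z" if "z \<in> - ?S" for z
        using that closure_subset[of "{x. \<psi> x \<noteq> 0}"] by auto
    qed
    then have "frechet_derivative \<psi> (at x) = (\<lambda>_. 0)"
      by (rule frechet_derivative_at[symmetric])
    then show ?thesis by simp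
  qed (use M in fastforce)
  then show ?thesis by (rule that)
qed

text \<open>
  Differentiating \<open>t \<mapsto> \<integral>\<^sub>E \<psi> (x - t y) dx\<close> under the integral gives the integral over \<open>E\<close> of the
  divergence of a test field of norm at most \<open>|y|\<close>; the mean value theorem does the rest.
\<close>

lemma smooth_translation_estimate:
  fixes \<psi> :: "'a::euclidean_space \<Rightarrow> real"
  assumes \<psi>: "smooth \<psi>" "bounded {x. \<psi> x \<noteq> 0}" and le1: "\<And>x. \<bar>\<psi> x\<bar> \<le> 1"
    and E[measurable]: "E \<in> sets borel" and fin: "emeasure lborel E < \<infinity>"
    and V: "\<And>\<phi>. \<phi> \<in> test_fields UNIV \<Longrightarrow> (\<And>x. norm (\<phi> x) \<le> 1) \<Longrightarrow>
      \<bar>\<integral>x. indicat_real E x * divergence \<phi> x \<partial>lborel\<bar> \<le> V"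
  shows "\<bar>(\<integral>x. indicat_real E x * \<psi> (x - y) \<partial>lborel) - (\<integral>x. indicat_real E x * \<psi> x \<partial>lborel)\<bar>
    \<le> V * norm y"
proof (cases "y = 0")
  case False
  let ?D = "\<lambda>x. frechet_derivative \<psi> (at x)"
  have D: "(\<psi> has_derivative ?D x) (at x)" for x
    using \<psi>(1) C_k_SucD(1)[of 0] unfolding smooth_def by blast
  have "C_k 0 \<psi>" using \<psi>(1) by (simp only: smooth_def)
  then have [measurable]: "\<psi> \<in> borel_measurable borel"
    by (auto intro: borel_measurable_continuous_onI)
  have "C_k 0 (\<lambda>x. ?D x y)" using \<psi>(1) C_k_SucD(2) by (auto simp only: smooth_def)
  then have [measurable]: "(\<lambda>x. ?D x y) \<in> borel_measurable borel"
    by (auto intro: borel_measurable_continuous_onI)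
  have intE: "integrable lborel (indicat_real E)"
    using fin by (simp add: less_top[symmetric])
  have int: "integrable lborel (\<lambda>x. indicat_real E x * \<psi> (x - c))" for c
    by (rule Bochner_Integration.integrable_bound[OF intE])
      (auto simp: indicator_def le1)
  obtain M where M: "\<And>x. \<bar>?D x y\<bar> \<le> M"
    using bounded_frechet_derivative[OF \<psi>] by metis
  have line: "((\<lambda>s. \<psi> (x - s *\<^sub>R y)) has_real_derivative - ?D (x - t *\<^sub>R y) y) (at t within S)" for x t S
  proof -
    have "((\<lambda>s. \<psi> (x - s *\<^sub>R y)) has_derivative (\<lambda>s. ?D (x - t *\<^sub>R y) (- (s *\<^sub>R y)))) (at t)"
      by (rule has_derivative_compose[OF _ D]) (auto intro!: derivative_eq_intros)
    also have "(\<lambda>s. ?D (x - t *\<^sub>R y) (- (s *\<^sub>R y))) = (*) (- ?D (x - t *\<^sub>R y) y)"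
      using has_derivative_linear[OF D, of "x - t *\<^sub>R y"]
      by (auto simp: fun_eq_iff linear_neg linear_cmul)
    finally show ?thesis
      unfolding has_field_derivative_def by (rule has_derivative_at_withinI)
  qed
  \<comment> \<open>This bounds all difference quotients by \<open>M\<close>, uniformly in
    \<open>x\<close>, so \<open>M\<close> times the indicator of \<open>E\<close> is an integrable
    majorant.\<close>
  have lip: "\<bar>\<psi> (x - s *\<^sub>R y) - \<psi> (x - t *\<^sub>R y)\<bar> \<le> M * \<bar>s - t\<bar>" for x s t
    using field_differentiable_bound[OF convex_UNIV line, where B = M and x = s and y = t] M by simp
  define h where "h t = (\<integral>x. indicat_real E x * \<psi> (x - t *\<^sub>R y) \<partial>lborel)" for t
  define h' where "h' t = (\<integral>x. indicat_real E x * - ?D (x - t *\<^sub>R y) y \<partial>lborel)" for t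
  \<comment> \<open>The limit is tested along sequences, to which dominated convergence
    applies.\<close>
  have deriv: "(h has_real_derivative h' t) (at t)" for t
    unfolding has_field_derivative_iff tendsto_at_iff_sequentially
  proof (intro allI impI)
    fix X assume X: "\<forall>i. X i \<in> UNIV - {t}" "X \<longlonglongrightarrow> t"
    define q where "q n x = indicat_real E x * ((\<psi> (x - X n *\<^sub>R y) - \<psi> (x - t *\<^sub>R y)) / (X n - t))" for n x
    have "(h (X n) - h t) / (X n - t) = (\<integral>x. q n x \<partial>lborel)" for n
    proof -
      have "h (X n) - h t = (\<integral>x. indicat_real E x * \<psi> (x - X n *\<^sub>R y) - indicat_real E x * \<psi> (x - t *\<^sub>R y) \<partial>lborel)"
        unfolding h_def by (intro Bochner_Integration.integral_diff[symmetric] int)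
      then show ?thesis
        by (simp add: q_def right_diff_distrib diff_divide_distrib flip: integral_divide_zero)
    qed
    moreover have "(\<lambda>n. \<integral>x. q n x \<partial>lborel) \<longlonglongrightarrow> h' t"
      unfolding h'_def
    proof (rule integral_dominated_convergence[where w = "\<lambda>x. M * indicat_real E x"])
      show "AE x in lborel. (\<lambda>n. q n x) \<longlonglongrightarrow> indicat_real E x * - ?D (x - t *\<^sub>R y) y"
      proof (rule AE_I2)
        fix x
        have "(\<lambda>n. (\<psi> (x - X n *\<^sub>R y) - \<psi> (x - t *\<^sub>R y)) / (X n - t)) \<longlonglongrightarrow> - ?D (x - t *\<^sub>R y) y"
          using line[of x t UNIV] X
          unfolding has_field_derivative_iff tendsto_at_iff_sequentially comp_def by blast
        then show "(\<lambda>n. q n x) \<longlonglongrightarrow> indicat_real E x * - ?D (x - t *\<^sub>R y) y"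
          unfolding q_def by (intro tendsto_mult tendsto_const)
      qed
      show "AE x in lborel. norm (q n x) \<le> M * indicat_real E x" for n
      proof (rule AE_I2)
        fix x
        have "X n \<noteq> t" using X by auto
        then show "norm (q n x) \<le> M * indicat_real E x"
          using lip[of x "X n" t] by (auto simp: q_def indicator_def field_simps abs_mult)
      qed
    qed (use intE in \<open>auto simp: q_def\<close>)
    ultimately show "((\<lambda>s. (h s - h t) / (s - t)) \<circ> X) \<longlonglongrightarrow> h' t"
      by (simp add: comp_def)
  qed
  have bound: "\<bar>h' t\<bar> \<le> V * norm y" for t
  proof -
    \<comment> \<open>\<open>sgn y\<close> keeps the field within norm 1, as the bound
      \<open>V\<close> demands; the factor \<open>norm y\<close> comes back by linearity of the
      derivative.\<close>
    define \<phi> where "\<phi> = (\<lambda>x. \<psi> (x - t *\<^sub>R y) *\<^sub>R sgn y)"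
    have "\<phi> \<in> test_fields UNIV"
      unfolding \<phi>_def by (rule translated_field_in_test_fields[OF \<psi>])
    moreover have "norm (\<phi> x) \<le> 1" for x
      using le1 by (auto simp: \<phi>_def norm_sgn)
    ultimately have *: "\<bar>\<integral>x. indicat_real E x * divergence \<phi> x \<partial>lborel\<bar> \<le> V"
      by (rule V)
    have "?D x y = norm y * ?D x (sgn y)" for x
      using linear_cmul[OF has_derivative_linear[OF D], of x "norm y" "sgn y"] False
      by (simp add: sgn_div_norm)
    then have "h' t = (\<integral>x. - norm y * (indicat_real E x * divergence \<phi> x) \<partial>lborel)"
      unfolding h'_def \<phi>_def divergence_translated_field[OF \<psi>(1)]
      by (intro Bochner_Integration.integral_cong) auto
    also have "\<dots> = - norm y * (\<integral>x. indicat_real E x * divergence \<phi> x \<partial>lborel)"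
      by (rule integral_mult_right_zero)
    finally have "\<bar>h' t\<bar> = norm y * \<bar>\<integral>x. indicat_real E x * divergence \<phi> x \<partial>lborel\<bar>"
      by (simp add: abs_mult)
    then show ?thesis
      using mult_left_mono[OF *, of "norm y"] by (simp add: mult.commute)
  qed
  obtain z where "h 1 - h 0 = (1 - 0) * h' z"
    using MVT2[of 0 1 h h'] deriv by auto
  then have "\<bar>h 1 - h 0\<bar> \<le> V * norm y" using bound by simp
  then show ?thesis by (simp add: h_def)
qed simp

text \<open>A change of variables moves the shift from \<open>E\<close> onto the smooth
  approximation of the indicator of \<open>U\<close>, where the smooth estimate applies with a bound
  independent of n. Dominated convergence then passes to \<open>U\<close>.\<close>

lemma open_translation_estimate:
  fixes E U :: "'a::euclidean_space set"
  assumes E[measurable]: "E \<in> sets borel" and fin: "emeasure lborel E < \<infinity>"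
    and V: "\<And>\<phi>. \<phi> \<in> test_fields UNIV \<Longrightarrow> (\<And>x. norm (\<phi> x) \<le> 1) \<Longrightarrow>
      \<bar>\<integral>x. indicat_real E x * divergence \<phi> x \<partial>lborel\<bar> \<le> V"
    and "open U"
  shows "(\<integral>x. indicat_real U x * (indicat_real E x - indicat_real E (x + y)) \<partial>lborel) \<le> V * norm y"
proof -
  obtain \<psi> :: "nat \<Rightarrow> 'a \<Rightarrow> real" where \<psi>: "\<And>n. smooth (\<psi> n)" "\<And>n. bounded {x. \<psi> n x \<noteq> 0}"
    "\<And>n x. 0 \<le> \<psi> n x \<and> \<psi> n x \<le> 1" "\<And>x. (\<lambda>n. \<psi> n x) \<longlonglongrightarrow> indicat_real U x"
    using smooth_approx_indicator_open[OF \<open>open U\<close>] by metis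
  have [measurable]: "\<psi> n \<in> borel_measurable borel" for n
  proof -
    have "C_k 0 (\<psi> n)" using \<psi>(1) by (simp only: smooth_def)
    then show ?thesis by (auto intro: borel_measurable_continuous_onI)
  qed
  have [measurable]: "U \<in> sets borel" using \<open>open U\<close> by simp
  have intE: "integrable lborel (indicat_real E)"
    using fin by (simp add: less_top[symmetric])
  note intE' = integrable_indicator_translate[OF E fin, of y]
  let ?f = "\<lambda>x. indicat_real E x - indicat_real E (x + y)"
  have "(\<integral>x. \<psi> n x * ?f x \<partial>lborel) \<le> V * norm y" for n
  proof -
    have le1: "\<bar>\<psi> n x\<bar> \<le> 1" for x using \<psi>(3)[of n x] by simp
    have i: "integrable lborel (\<lambda>x. indicat_real E x * \<psi> n x)"
      "integrable lborel (\<lambda>x. indicat_real E (x + y) * \<psi> n x)"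
      by (rule Bochner_Integration.integrable_bound[OF intE] Bochner_Integration.integrable_bound[OF intE'];
          auto simp: indicator_def le1)+
    have "(\<integral>x. \<psi> n x * ?f x \<partial>lborel) =
        (\<integral>x. indicat_real E x * \<psi> n x - indicat_real E (x + y) * \<psi> n x \<partial>lborel)"
      by (simp add: algebra_simps)
    also have "\<dots> = (\<integral>x. indicat_real E x * \<psi> n x \<partial>lborel) - (\<integral>x. indicat_real E (x + y) * \<psi> n x \<partial>lborel)"
      by (rule Bochner_Integration.integral_diff[OF i])
    also have "(\<integral>x. indicat_real E (x + y) * \<psi> n x \<partial>lborel) = (\<integral>x. indicat_real E x * \<psi> n (x - y) \<partial>lborel)"
      using lborel_integral_translate[of "\<lambda>x. indicat_real E x * \<psi> n (x - y)" y] by simp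
    finally show ?thesis
      using smooth_translation_estimate[OF \<psi>(1) \<psi>(2) le1 E fin V, where y = y] by auto
  qed
  moreover have "(\<lambda>n. \<integral>x. \<psi> n x * ?f x \<partial>lborel) \<longlonglongrightarrow> (\<integral>x. indicat_real U x * ?f x \<partial>lborel)"
  proof (rule integral_dominated_convergence[where w = "\<lambda>x. indicat_real E x + indicat_real E (x + y)"])
    show "AE x in lborel. (\<lambda>n. \<psi> n x * ?f x) \<longlonglongrightarrow> indicat_real U x * ?f x"
      by (intro AE_I2 tendsto_mult \<psi>(4) tendsto_const)
    show "AE x in lborel. norm (\<psi> n x * ?f x) \<le> indicat_real E x + indicat_real E (x + y)" for n
      using \<psi>(3)[of n] by (intro AE_I2) (auto simp: indicator_def)
  qed (use intE intE' in auto)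
  ultimately show ?thesis
    by (intro LIMSEQ_le_const2) auto
qed

text \<open>The set A of points of \<open>E\<close> whose shift leaves \<open>E\<close> is enclosed
  in an open set with excess below \<delta>, so that the estimate for open sets applies to it up to
  an error \<delta>. \<open>V\<close> is the total variation.\<close>

lemma finite_perimeter_translation_estimate:
  fixes E :: "'a::euclidean_space set"
  assumes E[measurable]: "E \<in> sets borel" and fin: "emeasure lborel E < \<infinity>" and "finite_perimeter E"
  obtains V where "V \<ge> 0" "\<And>y. emeasure lborel {x \<in> E. x + y \<notin> E} \<le> ennreal (V * norm y)"
proof -
  define T where "T = total_variation (distributional_gradient (indicat_real E)) UNIV"
  have "T < \<infinity>" using assms(3) unfolding finite_perimeter_def T_def .
  then obtain V where V: "V \<ge> 0" "T = ennreal V" by (cases T) auto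
  have *: "\<bar>\<integral>x. indicat_real E x * divergence \<phi> x \<partial>lborel\<bar> \<le> V"
    if "\<phi> \<in> test_fields UNIV" "\<And>x. norm (\<phi> x) \<le> 1" for \<phi>
  proof -
    have "ennreal \<bar>distributional_gradient (indicat_real E) \<phi>\<bar> \<le> T"
      unfolding T_def total_variation_UNIV by (rule SUP_upper) (use that in auto)
    then show ?thesis using V by (simp add: distributional_gradient_def)
  qed
  have "emeasure lborel {x \<in> E. x + y \<notin> E} \<le> ennreal (V * norm y)" for y
  proof -
    define A where "A = {x \<in> E. x + y \<notin> E}"
    have [measurable]: "A \<in> sets borel" unfolding A_def by measurable
    have finA: "emeasure lborel A < \<infinity>"
      using emeasure_mono[of A E lborel] fin by (auto simp: A_def)
    have "measure lborel A \<le> V * norm y + \<delta>" if "\<delta> > 0" for \<delta>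
    proof -
      obtain U where U: "open U" "A \<subseteq> U" "emeasure lborel (U - A) < ennreal \<delta>"
        using outer_regular_lborel[of A \<delta>] \<open>\<delta> > 0\<close> by auto
      have [measurable]: "U \<in> sets borel" using U by simp
      have finUA: "emeasure lborel (U - A) < \<infinity>" using U(3) by (rule less_trans) simp
      let ?f = "\<lambda>x. indicat_real E x - indicat_real E (x + y)"
      have "integrable lborel ?f"
        using integrable_indicator_translate[OF E fin, of y] fin by (simp add: less_top[symmetric])
      then have i: "integrable lborel (\<lambda>x. indicat_real U x * ?f x)"
        by (rule Bochner_Integration.integrable_bound) (auto simp: indicator_def)
      have j: "integrable lborel (indicat_real (U - A))"
        using finUA by (simp add: less_top[symmetric])
      have "measure lborel A = (\<integral>x. indicat_real A x \<partial>lborel)" by simp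
      also have "\<dots> \<le> (\<integral>x. indicat_real U x * ?f x + indicat_real (U - A) x \<partial>lborel)"
      proof (rule integral_mono)
        show "integrable lborel (indicat_real A)" using finA by (simp add: less_top[symmetric])
        show "integrable lborel (\<lambda>x. indicat_real U x * ?f x + indicat_real (U - A) x)"
          using i j by (rule Bochner_Integration.integrable_add)
        \<comment> \<open>The difference of indicators is 1 on \<open>A\<close> and is 0 or -1
          elsewhere; the last term compensates the negative values on \<open>U - A\<close>.\<close>
        show "indicat_real A x \<le> indicat_real U x * ?f x + indicat_real (U - A) x" for x
          using U(2) by (auto simp: indicator_def A_def)
      qed
      also have "\<dots> = (\<integral>x. indicat_real U x * ?f x \<partial>lborel) + measure lborel (U - A)"
        by (subst Bochner_Integration.integral_add[OF i j]) simp
      also have "\<dots> \<le> V * norm y + \<delta>"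
      proof (rule add_mono)
        show "(\<integral>x. indicat_real U x * ?f x \<partial>lborel) \<le> V * norm y"
          by (rule open_translation_estimate[OF E fin * U(1)])
        show "measure lborel (U - A) \<le> \<delta>"
          using U(3) \<open>\<delta> > 0\<close> finUA by (simp add: emeasure_eq_ennreal_measure ennreal_less_iff)
      qed
      finally show ?thesis .
    qed
    then have "measure lborel A \<le> V * norm y" by (rule field_le_epsilon)
    then show ?thesis
      using finA unfolding A_def[symmetric]
      by (simp add: emeasure_eq_ennreal_measure ennreal_leI less_top)
  qed
  with V(1) show ?thesis by (rule that)
qed

subsection \<open>Non-local perimeters and escaping mass\<close>

text \<open>By Markov's inequality the complement of every ball around the origin has finite
  measure, and the origin is null. Sigma-finiteness is what Tonelli requires of
  \<open>\<nu>\<close>.\<close>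

lemma sigma_finite_if_levy:
  fixes \<nu> :: "'a::euclidean_space measure"
  assumes sets[measurable_cong]: "sets \<nu> = sets borel"
    and levy: "(\<integral>\<^sup>+x. ennreal (min 1 (norm x)) \<partial>\<nu>) < \<infinity>"
    and null: "emeasure \<nu> {0} = 0"
  shows "sigma_finite_measure \<nu>"
proof
  define A where "A n = {x::'a. 1 / real (Suc n) \<le> norm x}" for n
  have [measurable]: "A n \<in> sets borel" for n unfolding A_def by measurable
  have fin: "emeasure \<nu> (A n) < \<infinity>" for n
  proof -
    have le: "ennreal (1 / real (Suc n)) * indicator (A n) x \<le> ennreal (min 1 (norm x))" for x
      by (auto simp: A_def indicator_def simp del: of_nat_Suc intro!: ennreal_leI)
    have "ennreal (1 / real (Suc n)) * emeasure \<nu> (A n) = (\<integral>\<^sup>+x. ennreal (1 / real (Suc n)) * indicator (A n) x \<partial>\<nu>)"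
      by (rule nn_integral_cmult_indicator[symmetric]) simp
    also have "\<dots> \<le> (\<integral>\<^sup>+x. ennreal (min 1 (norm x)) \<partial>\<nu>)"
      by (intro nn_integral_mono le)
    also have "\<dots> < \<infinity>" by (rule levy)
    finally show ?thesis by (auto simp: ennreal_mult_less_top)
  qed
  have cover: "x \<in> insert 0 (\<Union>n. A n)" for x
  proof (cases "x = 0")
    case False
    then obtain n where "inverse (real (Suc n)) < norm x"
      using reals_Archimedean[of "norm x"] by auto
    then show ?thesis by (auto simp: A_def inverse_eq_divide intro!: exI[of _ n])
  qed simp
  have "\<Union> (insert {0} (range A)) = space \<nu>"
    using cover sets_eq_imp_space_eq[OF sets] by auto
  then show "\<exists>A. countable A \<and> A \<subseteq> sets \<nu> \<and> \<Union> A = space \<nu> \<and> (\<forall>a\<in>A. emeasure \<nu> a \<noteq> \<infinity>)"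
    using null fin
    by (intro exI[of _ "insert {0} (range A)"] conjI) (auto simp: sets less_top)
qed

text \<open>Both sides integrate the indicator of the pairs with x in \<open>E\<close> and x + y
  outside \<open>E\<close>, in the two possible orders.\<close>

lemma nonlocal_perimeter_eq:
  fixes \<nu> :: "'a::euclidean_space measure"
  assumes "sigma_finite_measure \<nu>" and sets[measurable_cong]: "sets \<nu> = sets borel"
    and E[measurable]: "E \<in> sets borel"
  shows "nonlocal_perimeter \<nu> E = (\<integral>\<^sup>+y. emeasure lborel {x \<in> E. x + y \<notin> E} \<partial>\<nu>)"
proof -
  interpret \<nu>: sigma_finite_measure \<nu> by fact
  interpret pair_sigma_finite lborel \<nu> ..
  define f :: "'a \<times> 'a \<Rightarrow> ennreal" where "f = (\<lambda>(x, y). indicator E x * indicator (- E) (x + y))"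
  have f[measurable]: "f \<in> borel_measurable (lborel \<Otimes>\<^sub>M \<nu>)" unfolding f_def by measurable
  have y: "emeasure lborel {x \<in> E. x + y \<notin> E} = (\<integral>\<^sup>+x. f (x, y) \<partial>lborel)" for y
  proof -
    have "emeasure lborel {x \<in> E. x + y \<notin> E} = (\<integral>\<^sup>+x. indicator {x \<in> E. x + y \<notin> E} x \<partial>lborel)"
      by (rule nn_integral_indicator[symmetric]) measurable
    also have "\<dots> = (\<integral>\<^sup>+x. f (x, y) \<partial>lborel)"
      by (rule nn_integral_cong) (auto simp: f_def indicator_def)
    finally show ?thesis .
  qed
  have "emeasure \<nu> ((\<lambda>z. z - x) ` (- E)) * indicator E x = (\<integral>\<^sup>+y. f (x, y) \<partial>\<nu>)" for x
  proof -
    have eq: "(\<lambda>z. z - x) ` (- E) = {y. x + y \<in> - E}"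
      by (force intro: image_eqI[of _ _ "x + _"])
    have "{y. x + y \<in> - E} \<in> sets borel" by measurable
    then have "emeasure \<nu> {y. x + y \<in> - E} = (\<integral>\<^sup>+y. indicator {y. x + y \<in> - E} y \<partial>\<nu>)"
      by (intro nn_integral_indicator[symmetric]) (simp add: sets)
    also have "\<dots> = (\<integral>\<^sup>+y. indicator (- E) (x + y) \<partial>\<nu>)"
      by (intro nn_integral_cong) (simp add: indicator_def)
    finally show ?thesis
      unfolding eq f_def by (simp add: nn_integral_cmult mult.commute)
  qed
  then have "nonlocal_perimeter \<nu> E = (\<integral>\<^sup>+x. \<integral>\<^sup>+y. f (x, y) \<partial>\<nu> \<partial>lborel)"
    by (simp add: nonlocal_perimeter_def)
  also have "\<dots> = (\<integral>\<^sup>+y. \<integral>\<^sup>+x. f (x, y) \<partial>lborel \<partial>\<nu>)"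
    using Fubini[OF f] by simp
  finally show ?thesis
    by (simp add: y)
qed

text \<open>Choose n such that the part of \<open>E\<close> outside the ball of radius n has measure
  below \<delta>/2. If |y| > 2n, then x and x + y cannot both lie in that ball, so a point of
  \<open>E\<close> whose shift stays in \<open>E\<close> has x or x + y in this tail; the two cases
  cost \<delta>/2 each.\<close>

lemma emeasure_translate_difference_far:
  fixes E :: "'a::euclidean_space set"
  assumes E[measurable]: "E \<in> sets borel" and fin: "emeasure lborel E < \<infinity>" and "\<delta> > (0::real)"
  obtains r where "r \<ge> 1"
    "\<And>y. norm y > r \<Longrightarrow> emeasure lborel E \<le> emeasure lborel {x \<in> E. x + y \<notin> E} + ennreal \<delta>"
proof -
  let ?A = "\<lambda>n::nat. E - cball 0 (real n)"
  have "(\<lambda>n. emeasure lborel (?A n)) \<longlonglongrightarrow> emeasure lborel (\<Inter>n. ?A n)"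
  proof (rule Lim_emeasure_decseq)
    have "emeasure lborel (?A n) \<le> emeasure lborel E" for n
      by (rule emeasure_mono) auto
    then show "emeasure lborel (?A n) \<noteq> \<infinity>" for n
      using fin by (metis leD)
  qed (auto simp: decseq_def)
  also have "(\<Inter>n. ?A n) = {}"
    by (auto intro: real_arch_simple)
  finally have "(\<lambda>n. emeasure lborel (?A n)) \<longlonglongrightarrow> 0" by simp
  then have "\<forall>\<^sub>F n in sequentially. emeasure lborel (?A n) < ennreal (\<delta> / 2)"
    by (rule order_tendstoD) (use \<open>\<delta> > 0\<close> in simp)
  then obtain n where n: "emeasure lborel (?A n) < ennreal (\<delta> / 2)"
    by (auto simp: eventually_sequentially)
  have "emeasure lborel E \<le> emeasure lborel {x \<in> E. x + y \<notin> E} + ennreal \<delta>"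
    \<comment> \<open>The radius is kept at least 1, where the truncated weight is already
      1.\<close>
    if y: "norm y > max 1 (2 * real n)" for y
  proof -
    let ?B = "{x. x + y \<in> ?A n}" and ?G = "{x \<in> E. x + y \<notin> E}"
    have sub: "E \<subseteq> ?G \<union> (?A n \<union> ?B)"
    proof
      fix x assume "x \<in> E"
      have "norm y \<le> norm (x + y) + norm x" using norm_triangle_ineq4[of "x + y" x] by simp
      then show "x \<in> ?G \<union> (?A n \<union> ?B)" using \<open>x \<in> E\<close> y by auto
    qed
    have [measurable]: "?A n \<in> sets borel" by simp
    have meas: "?G \<in> sets lborel" "?A n \<in> sets lborel" "?B \<in> sets lborel"
      by measurable
    have "emeasure lborel E \<le> emeasure lborel (?G \<union> (?A n \<union> ?B))"
      using meas by (intro emeasure_mono sub) auto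
    also have "\<dots> \<le> emeasure lborel ?G + emeasure lborel (?A n \<union> ?B)"
      using meas by (intro emeasure_subadditive) auto
    also have "\<dots> \<le> emeasure lborel ?G + (emeasure lborel (?A n) + emeasure lborel ?B)"
      using meas by (intro add_left_mono emeasure_subadditive) auto
    also have "emeasure lborel ?B = emeasure lborel (?A n)"
      by (rule emeasure_lborel_translate) simp
    also have "emeasure lborel ?G + (emeasure lborel (?A n) + emeasure lborel (?A n))
        \<le> emeasure lborel ?G + (ennreal (\<delta> / 2) + ennreal (\<delta> / 2))"
      using n by (intro add_left_mono add_mono) auto
    also have "ennreal (\<delta> / 2) + ennreal (\<delta> / 2) = ennreal \<delta>"
      using \<open>\<delta> > 0\<close> by (simp flip: ennreal_plus)
    finally show ?thesis .
  qed
  then show ?thesis by (intro that[of "max 1 (2 * real n)"]) auto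
qed

section \<open>The normalised truncated measures\<close>

lemma measurable_trunc_weight[measurable]:
  "trunc_weight r \<in> borel_measurable borel"
  unfolding trunc_weight_def by measurable

lemma emeasure_trunc_normalized:
  fixes \<nu> :: "'a::euclidean_space measure"
  assumes sets[measurable_cong]: "sets \<nu> = sets borel" and [measurable]: "A \<in> sets borel"
  shows "emeasure (trunc_normalized r \<nu>) A =
    inverse (trunc_mass r \<nu>) * (\<integral>\<^sup>+x. trunc_weight r x * indicator A x \<partial>\<nu>)"
  unfolding trunc_normalized_def
  by (subst emeasure_density) (auto simp: sets mult.assoc nn_integral_cmult)

text \<open>Normalisation gives total mass 1, so mass escaping to infinity forces the mass of balls
  to vanish.\<close>

lemma emeasure_trunc_normalized_Compl:
  fixes \<nu> :: "'a::euclidean_space measure"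
  assumes sets: "sets \<nu> = sets borel" and [measurable]: "A \<in> sets borel"
    and C: "0 < trunc_mass r \<nu>" "trunc_mass r \<nu> < \<infinity>"
  shows "emeasure (trunc_normalized r \<nu>) A = 1 - emeasure (trunc_normalized r \<nu>) (- A)"
proof -
  let ?N = "trunc_normalized r \<nu>"
  have sN: "sets ?N = sets borel" by (simp add: trunc_normalized_def sets)
  have "emeasure ?N UNIV = inverse (trunc_mass r \<nu>) * trunc_mass r \<nu>"
    by (simp add: emeasure_trunc_normalized[OF sets] trunc_mass_def)
  also have "\<dots> = 1" using C by (simp add: mult.commute less_top ennreal_divide_self flip: divide_ennreal_def)
  finally have 1: "emeasure ?N UNIV = 1" .
  have "emeasure ?N (UNIV - - A) = emeasure ?N UNIV - emeasure ?N (- A)"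
  proof (rule emeasure_Diff)
    show "emeasure ?N (- A) \<noteq> \<infinity>"
      using emeasure_mono[of "- A" UNIV ?N] 1 sN by (auto simp: top_unique)
  qed (auto simp: sN)
  then show ?thesis by (simp add: 1 Compl_eq_Diff_UNIV[symmetric])
qed

text \<open>The common core of both claims. The finite constant \<open>K\<close> abstracts the
  source of the bound near the origin: it will be |E| + V for finite perimeter and |E| for infinite
  \<open>R\<close>. The limit is squeezed between two expressions in the escaping mass.\<close>

lemma tendsto_normalized_perimeter:
  fixes \<nu> :: "'i \<Rightarrow> 'a::euclidean_space measure" and R :: "'i \<Rightarrow> ennreal"
  assumes ev: "\<forall>\<^sub>F \<epsilon> in F. sets (\<nu> \<epsilon>) = sets borel \<and> sigma_finite_measure (\<nu> \<epsilon>) \<and> 1 \<le> R \<epsilon> \<and>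
      0 < trunc_mass (R \<epsilon>) (\<nu> \<epsilon>) \<and> trunc_mass (R \<epsilon>) (\<nu> \<epsilon>) < \<infinity> \<and>
      (\<forall>y. emeasure lborel {x \<in> E. x + y \<notin> E} \<le> K * trunc_weight (R \<epsilon>) y)"
    and escape: "\<And>r::real. r > 0 \<Longrightarrow>
      ((\<lambda>\<epsilon>. emeasure (trunc_normalized (R \<epsilon>) (\<nu> \<epsilon>)) (- cball 0 r)) \<longlongrightarrow> 1) F"
    and E[measurable]: "E \<in> sets borel" and fin: "emeasure lborel E < \<infinity>" and K: "K < \<infinity>"
  shows "((\<lambda>\<epsilon>. inverse (trunc_mass (R \<epsilon>) (\<nu> \<epsilon>)) * nonlocal_perimeter (\<nu> \<epsilon>) E)
    \<longlongrightarrow> emeasure lborel E) F"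
proof -
  define g where "g y = emeasure lborel {x \<in> E. x + y \<notin> E}" for y
  define \<Lambda> where "\<Lambda> r \<epsilon> = emeasure (trunc_normalized (R \<epsilon>) (\<nu> \<epsilon>)) (- cball 0 r)" for r \<epsilon>
  let ?P = "\<lambda>\<epsilon>. inverse (trunc_mass (R \<epsilon>) (\<nu> \<epsilon>)) * nonlocal_perimeter (\<nu> \<epsilon>) E"
  let ?e = "emeasure lborel E"
  have g_le: "g y \<le> ?e" for y unfolding g_def by (rule emeasure_mono) auto
  have w1: "trunc_weight s y = 1" if "1 \<le> s" "1 \<le> norm y" for s and y :: 'a
    using mult_mono[OF that(1), of 1 "ennreal (norm y)"] that(2)
    by (simp add: trunc_weight_def min_def)
  \<comment> \<open>In the unit ball \<open>g\<close> is at most \<open>K\<close> times the weight;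
    outside it the weight is 1 because \<open>R \<epsilon> \<ge> 1\<close>, and \<open>g\<close> is
    at most |E|. Dividing by the mass turns the two pieces into masses of the normalised
    measure.\<close>
  have upper: "\<forall>\<^sub>F \<epsilon> in F. ?P \<epsilon> \<le> K * (1 - \<Lambda> 1 \<epsilon>) + ?e * \<Lambda> 1 \<epsilon>"
    using ev
  proof eventually_elim
    case (elim \<epsilon>)
    then have sets[measurable_cong]: "sets (\<nu> \<epsilon>) = sets borel" and sf: "sigma_finite_measure (\<nu> \<epsilon>)"
      and R: "1 \<le> R \<epsilon>" and C: "0 < trunc_mass (R \<epsilon>) (\<nu> \<epsilon>)" "trunc_mass (R \<epsilon>) (\<nu> \<epsilon>) < \<infinity>"
      and gK: "\<And>y. g y \<le> K * trunc_weight (R \<epsilon>) y"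
      by (auto simp: g_def)
    let ?w = "trunc_weight (R \<epsilon>) :: 'a \<Rightarrow> ennreal" and ?c = "inverse (trunc_mass (R \<epsilon>) (\<nu> \<epsilon>))"
    let ?B = "cball 0 1 :: 'a set"
    have [measurable]: "?B \<in> sets borel" by simp
    have "nonlocal_perimeter (\<nu> \<epsilon>) E = (\<integral>\<^sup>+y. g y \<partial>\<nu> \<epsilon>)"
      unfolding g_def by (rule nonlocal_perimeter_eq[OF sf sets E])
    also have "\<dots> \<le> (\<integral>\<^sup>+y. K * (?w y * indicator ?B y) + ?e * (?w y * indicator (- ?B) y) \<partial>\<nu> \<epsilon>)"
    proof (rule nn_integral_mono)
      fix y
      show "g y \<le> K * (?w y * indicator ?B y) + ?e * (?w y * indicator (- ?B) y)"
        using gK[of y] g_le[of y] w1[OF R, of y] by (auto simp: indicator_def)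
    qed
    also have "\<dots> = K * (\<integral>\<^sup>+y. ?w y * indicator ?B y \<partial>\<nu> \<epsilon>) + ?e * (\<integral>\<^sup>+y. ?w y * indicator (- ?B) y \<partial>\<nu> \<epsilon>)"
      by (subst nn_integral_add) (auto simp: nn_integral_cmult)
    finally have "?P \<epsilon> \<le> ?c * (K * (\<integral>\<^sup>+y. ?w y * indicator ?B y \<partial>\<nu> \<epsilon>) + ?e * (\<integral>\<^sup>+y. ?w y * indicator (- ?B) y \<partial>\<nu> \<epsilon>))"
      by (rule mult_left_mono) simp
    also have "\<dots> = K * emeasure (trunc_normalized (R \<epsilon>) (\<nu> \<epsilon>)) ?B + ?e * \<Lambda> 1 \<epsilon>"
      unfolding \<Lambda>_def by (simp add: emeasure_trunc_normalized[OF sets] distrib_left mult_ac)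
    also have "emeasure (trunc_normalized (R \<epsilon>) (\<nu> \<epsilon>)) ?B = 1 - \<Lambda> 1 \<epsilon>"
      unfolding \<Lambda>_def by (rule emeasure_trunc_normalized_Compl[OF sets _ C]) simp
    finally show ?case .
  qed
  \<comment> \<open>Only the points beyond radius \<open>r\<close> are kept, where the weight is 1
    and \<open>g\<close> is at least |E| - \<delta>.\<close>
  have lower: "\<forall>\<^sub>F \<epsilon> in F. (?e - ennreal \<delta>) * \<Lambda> r \<epsilon> \<le> ?P \<epsilon>"
    if r: "r \<ge> 1" "\<And>y. norm y > r \<Longrightarrow> ?e \<le> g y + ennreal \<delta>" for r \<delta>
    using ev
  proof eventually_elim
    case (elim \<epsilon>)
    then have sets[measurable_cong]: "sets (\<nu> \<epsilon>) = sets borel" and sf: "sigma_finite_measure (\<nu> \<epsilon>)"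
      and R: "1 \<le> R \<epsilon>"
      by auto
    let ?w = "trunc_weight (R \<epsilon>) :: 'a \<Rightarrow> ennreal" and ?c = "inverse (trunc_mass (R \<epsilon>) (\<nu> \<epsilon>))"
    let ?B = "cball 0 r :: 'a set"
    have [measurable]: "?B \<in> sets borel" by simp
    have "(?e - ennreal \<delta>) * \<Lambda> r \<epsilon> = ?c * (\<integral>\<^sup>+y. (?e - ennreal \<delta>) * (?w y * indicator (- ?B) y) \<partial>\<nu> \<epsilon>)"
      unfolding \<Lambda>_def
      by (subst nn_integral_cmult) (auto simp: emeasure_trunc_normalized[OF sets] mult_ac)
    also have "\<dots> \<le> ?c * (\<integral>\<^sup>+y. g y \<partial>\<nu> \<epsilon>)"
    proof (intro mult_left_mono nn_integral_mono)
      fix y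
      have "?e - ennreal \<delta> \<le> g y" if "norm y > r"
        using r(2)[OF that] by (simp add: ennreal_minus_le_iff add.commute)
      then show "(?e - ennreal \<delta>) * (?w y * indicator (- ?B) y) \<le> g y"
        using w1[OF R, of y] r(1) by (auto simp: indicator_def)
    qed simp
    also have "(\<integral>\<^sup>+y. g y \<partial>\<nu> \<epsilon>) = nonlocal_perimeter (\<nu> \<epsilon>) E"
      unfolding g_def by (rule nonlocal_perimeter_eq[OF sf sets E, symmetric])
    finally show ?case .
  qed
  have \<Lambda>: "(\<Lambda> r \<longlongrightarrow> 1) F" if "r \<ge> 1" for r
    using escape[of r] that unfolding \<Lambda>_def by simp
  show ?thesis
  proof (rule order_tendstoI)
    fix a assume "a < ?e"
    then obtain b where b: "a < b" "b < ?e" using dense by blast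
    \<comment> \<open>This makes |E| - \<delta> equal to \<open>b\<close>, which still exceeds
      \<open>a\<close>; finiteness of |E| makes the subtraction reversible.\<close>
    define \<delta> where "\<delta> = enn2real (?e - b)"
    have "?e - b < \<infinity>" using fin by (auto simp: less_top[symmetric])
    moreover have "?e - b > 0" using b(2) by (simp add: diff_gr0_ennreal)
    ultimately have \<delta>: "\<delta> > 0" "ennreal \<delta> = ?e - b"
      by (auto simp: \<delta>_def enn2real_positive_iff ennreal_enn2real_if)
    obtain r where r: "r \<ge> 1" "\<And>y. norm y > r \<Longrightarrow> ?e \<le> g y + ennreal \<delta>"
      using emeasure_translate_difference_far[OF E fin \<delta>(1)] unfolding g_def by blast
    have "((\<lambda>\<epsilon>. (?e - ennreal \<delta>) * \<Lambda> r \<epsilon>) \<longlongrightarrow> (?e - ennreal \<delta>) * 1) F"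
      using fin by (intro ennreal_tendsto_cmult \<Lambda> r) (auto simp: less_top[symmetric])
    moreover have "?e - ennreal \<delta> = b"
      using b(2) fin unfolding \<delta>(2) by (intro diff_diff_ennreal) auto
    ultimately have "((\<lambda>\<epsilon>. (?e - ennreal \<delta>) * \<Lambda> r \<epsilon>) \<longlongrightarrow> b) F" by simp
    then have "\<forall>\<^sub>F \<epsilon> in F. a < (?e - ennreal \<delta>) * \<Lambda> r \<epsilon>"
      using b(1) by (rule order_tendstoD)
    moreover have "\<forall>\<^sub>F \<epsilon> in F. (?e - ennreal \<delta>) * \<Lambda> r \<epsilon> \<le> ?P \<epsilon>"
      using r by (rule lower)
    ultimately show "\<forall>\<^sub>F \<epsilon> in F. a < ?P \<epsilon>"
      by eventually_elim (rule less_le_trans)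
  next
    fix a assume a: "?e < a"
    \<comment> \<open>The finite \<open>K\<close> meets the vanishing mass of the unit ball, so only
      |E| survives.\<close>
    have "((\<lambda>\<epsilon>. K * (1 - \<Lambda> 1 \<epsilon>) + ?e * \<Lambda> 1 \<epsilon>) \<longlongrightarrow> K * (1 - 1) + ?e * 1) F"
      using fin K by (intro tendsto_add ennreal_tendsto_cmult tendsto_diff_ennreal_general \<Lambda> tendsto_const) auto
    then have "\<forall>\<^sub>F \<epsilon> in F. K * (1 - \<Lambda> 1 \<epsilon>) + ?e * \<Lambda> 1 \<epsilon> < a"
      by (rule order_tendstoD) (use a in simp)
    then show "\<forall>\<^sub>F \<epsilon> in F. ?P \<epsilon> < a"
      using upper by eventually_elim (rule le_less_trans)
  qed
qed

text \<open>The second claim takes \<open>R \<epsilon> = \<infinity>\<close>, so that the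
  normalising mass is the total mass. With finite \<open>R \<epsilon>\<close>, escape of the
  weighted mass would still allow the unweighted mass to concentrate near the origin, where the
  weight is small.\<close>

theorem theorem3p11:
  fixes \<nu> :: "real \<Rightarrow> 'a::euclidean_space measure"
    and R :: "real \<Rightarrow> ennreal"
  assumes borel: "\<And>\<epsilon>. \<epsilon> > 0 \<Longrightarrow> sets (\<nu> \<epsilon>) = sets borel"
    and levy: "\<And>\<epsilon>. \<epsilon> > 0 \<Longrightarrow> (\<integral>\<^sup>+x. ennreal (min 1 (norm x)) \<partial>\<nu> \<epsilon>) < \<infinity>"
    and null_origin: "\<And>\<epsilon>. \<epsilon> > 0 \<Longrightarrow> emeasure (\<nu> \<epsilon>) {0} = 0"
    and R_ge_1: "\<And>\<epsilon>. \<epsilon> > 0 \<Longrightarrow> 1 \<le> R \<epsilon>"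
    and C_pos: "\<And>\<epsilon>. \<epsilon> > 0 \<Longrightarrow> 0 < trunc_mass (R \<epsilon>) (\<nu> \<epsilon>)"
    and C_finite: "\<And>\<epsilon>. \<epsilon> > 0 \<Longrightarrow> trunc_mass (R \<epsilon>) (\<nu> \<epsilon>) < \<infinity>"
    and escape: "\<And>r::real. r > 0 \<Longrightarrow>
      ((\<lambda>\<epsilon>. emeasure (trunc_normalized (R \<epsilon>) (\<nu> \<epsilon>)) (- cball 0 r)) \<longlongrightarrow> 1) (at_right 0)"
  shows "(\<forall>E. E \<in> sets borel \<and> emeasure lborel E < \<infinity> \<and> finite_perimeter E \<longrightarrow>
      ((\<lambda>\<epsilon>. inverse (trunc_mass (R \<epsilon>) (\<nu> \<epsilon>)) * nonlocal_perimeter (\<nu> \<epsilon>) E)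
        \<longlongrightarrow> emeasure lborel E) (at_right 0))
    \<and> ((\<forall>\<epsilon>>0. finite_measure (\<nu> \<epsilon>)) \<and> (\<forall>\<epsilon>>0. R \<epsilon> = \<infinity>) \<longrightarrow>
      (\<forall>E. E \<in> sets borel \<and> emeasure lborel E < \<infinity> \<longrightarrow>
        ((\<lambda>\<epsilon>. inverse (emeasure (\<nu> \<epsilon>) UNIV) * nonlocal_perimeter (\<nu> \<epsilon>) E)
          \<longlongrightarrow> emeasure lborel E) (at_right 0)))"
proof -
  have main: "((\<lambda>\<epsilon>. inverse (trunc_mass (R \<epsilon>) (\<nu> \<epsilon>)) * nonlocal_perimeter (\<nu> \<epsilon>) E)
      \<longlongrightarrow> emeasure lborel E) (at_right 0)"
    if E: "E \<in> sets borel" "emeasure lborel E < \<infinity>" and K: "K < \<infinity>"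
      and le: "\<And>\<epsilon> y. \<epsilon> > 0 \<Longrightarrow> emeasure lborel {x \<in> E. x + y \<notin> E} \<le> K * trunc_weight (R \<epsilon>) y" for E K
  proof (rule tendsto_normalized_perimeter[OF _ escape E K])
    show "\<forall>\<^sub>F \<epsilon> in at_right 0. sets (\<nu> \<epsilon>) = sets borel \<and> sigma_finite_measure (\<nu> \<epsilon>) \<and> 1 \<le> R \<epsilon> \<and>
        0 < trunc_mass (R \<epsilon>) (\<nu> \<epsilon>) \<and> trunc_mass (R \<epsilon>) (\<nu> \<epsilon>) < \<infinity> \<and>
        (\<forall>y. emeasure lborel {x \<in> E. x + y \<notin> E} \<le> K * trunc_weight (R \<epsilon>) y)"
      using eventually_at_right_less[of 0]
      by eventually_elim
        (intro conjI allI borel sigma_finite_if_levy levy null_origin R_ge_1 C_pos C_finite le)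
  qed
  show ?thesis
  proof (intro conjI allI impI; elim conjE)
    fix E :: "'a set"
    assume E: "E \<in> sets borel" "emeasure lborel E < \<infinity>" "finite_perimeter E"
    obtain V where V: "V \<ge> 0" "\<And>y. emeasure lborel {x \<in> E. x + y \<notin> E} \<le> ennreal (V * norm y)"
      using finite_perimeter_translation_estimate[OF E] by blast
    show "((\<lambda>\<epsilon>. inverse (trunc_mass (R \<epsilon>) (\<nu> \<epsilon>)) * nonlocal_perimeter (\<nu> \<epsilon>) E)
      \<longlongrightarrow> emeasure lborel E) (at_right 0)"
    proof (rule main[OF E(1,2)])
      \<comment> \<open>The weight is a minimum: |E| handles the value 1, and \<open>V\<close>
        handles \<open>R \<epsilon>\<close> times the norm, since
        \<open>R \<epsilon> \<ge> 1\<close>. The sum dominates both.\<close>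
      let ?K = "emeasure lborel E + ennreal V"
      show "?K < \<infinity>" using E(2) by simp
      fix \<epsilon> :: real and y :: 'a assume "\<epsilon> > 0"
      let ?g = "emeasure lborel {x \<in> E. x + y \<notin> E}"
      have "?g \<le> emeasure lborel E" using E(1) by (intro emeasure_mono) auto
      then have 1: "?g \<le> ?K * 1" by (simp add: add_increasing2)
      have "?g \<le> ennreal V * ennreal (norm y)" using V by (simp add: ennreal_mult)
      also have "\<dots> \<le> ?K * (R \<epsilon> * ennreal (norm y))"
        using mult_right_mono[OF R_ge_1[OF \<open>\<epsilon> > 0\<close>], of "ennreal (norm y)"]
        by (intro mult_mono) (auto simp: add_increasing)
      finally have 2: "?g \<le> ?K * (R \<epsilon> * ennreal (norm y))" .
      show "?g \<le> ?K * trunc_weight (R \<epsilon>) y"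
        unfolding trunc_weight_def min_def using 1 2 by (simp split: if_split)
    qed
  next
    fix E :: "'a set"
    assume R: "\<forall>\<epsilon>>0. R \<epsilon> = \<infinity>" and E: "E \<in> sets borel" "emeasure lborel E < \<infinity>"
    \<comment> \<open>Off the origin the weight is 1 and the trivial bound by |E| suffices; at y = 0
      both sides vanish.\<close>
    have "emeasure lborel {x \<in> E. x + y \<notin> E} \<le> emeasure lborel E * trunc_weight \<infinity> y" for y
    proof (cases "y = 0")
      case False
      then show ?thesis using E(1) by (auto simp: trunc_weight_infinity[simplified] intro!: emeasure_mono)
    qed simp
    then have "((\<lambda>\<epsilon>. inverse (trunc_mass (R \<epsilon>) (\<nu> \<epsilon>)) * nonlocal_perimeter (\<nu> \<epsilon>) E)
        \<longlongrightarrow> emeasure lborel E) (at_right 0)"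
      using R by (intro main[OF E E(2)]) auto
    moreover have "\<forall>\<^sub>F \<epsilon> in at_right 0. inverse (trunc_mass (R \<epsilon>) (\<nu> \<epsilon>)) * nonlocal_perimeter (\<nu> \<epsilon>) E =
        inverse (emeasure (\<nu> \<epsilon>) UNIV) * nonlocal_perimeter (\<nu> \<epsilon>) E"
      using eventually_at_right_less[of 0]
    proof eventually_elim
      case (elim \<epsilon>)
      have space: "space (\<nu> \<epsilon>) = UNIV" using sets_eq_imp_space_eq[OF borel[OF elim]] by simp
      \<comment> \<open>The infinite-radius weight differs from 1 only at the origin, a null set, so
        its integral is the total mass.\<close>
      have "{0} \<in> null_sets (\<nu> \<epsilon>)"
        using null_origin[OF elim] by (auto simp: null_sets_def borel[OF elim])
      then have "AE x in \<nu> \<epsilon>. trunc_weight \<infinity> x = 1"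
        by (rule AE_I') (use trunc_weight_infinity in auto)
      then have "trunc_mass \<infinity> (\<nu> \<epsilon>) = (\<integral>\<^sup>+x. 1 \<partial>\<nu> \<epsilon>)"
        unfolding trunc_mass_def by (rule nn_integral_cong_AE)
      then show ?case using R elim by (simp add: space)
    qed
    ultimately show "((\<lambda>\<epsilon>. inverse (emeasure (\<nu> \<epsilon>) UNIV) * nonlocal_perimeter (\<nu> \<epsilon>) E)
        \<longlongrightarrow> emeasure lborel E) (at_right 0)"
      by (rule Lim_transform_eventually)
  qed
qed

end
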